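(* Let $n \ge 2$, $d \ge 1$, $w>0$, $\varepsilon>0$, $\tau>0$, let $\bm{x} = [x_1^T \ x_2^T \ \dots \ x_n^T]^T \in \mathbb{R}^{nd}$ with $x_1,\dots,x_n \in \mathbb{R}^d$ pairwise distinct, and let $g(\bm{x}) = \tau - \det\left(P^T\mathcal{L}(\bm{x})P\right)$, where $\mathcal{L}(\bm{x})$ is the weighted Laplacian matrix of the configuration $\bm{x}$ and $P\in\mathbb{R}^{n\times(n-1)}$ has orthonormal columns, each orthogonal to $\bm{1}_n$. If $g(\bm{x}) = 0$, then $\nabla g(\bm{x}) \neq \bm{0}$.
   Context: For node positions $x_1,\dots,x_n\in\mathbb{R}^d$ stacked into $\bm{x}\in\mathbb{R}^{nd}$, the weighted adjacency matrix $A(\bm{x}) = (a_{ij}(\bm{x}))\in\mathbb{R}^{n\times n}$ is defined by $a_{ii}(\bm{x}) = 0$ and $a_{ij}(\bm{x}) = \sigma_w(\varepsilon - \|x_i-x_j\|)$ for $i\ne j$, where $\sigma_w(y) = 1/(1+e^{-wy})$, $w>0$, $\varepsilon>0$, and $\|\cdot\|$ is the Euclidean norm. The weighted Laplacian is $\mathcal{L}(\bm{x}) = \Delta(\bm{x}) - A(\bm{x})$, where $\Delta(\bm{x})$ is the diagonal matrix with $i$-th diagonal entry $\sum_{j=1}^n a_{ij}(\bm{x})$. $\bm{1}_n\in\mathbb{R}^n$ is the all-ones vector. $P = [p_1\ \dots\ p_{n-1}]\in\mathbb{R}^{n\times(n-1)}$ is a fixed matrix with orthonormal columns satisfying $p_i^T\bm{1}_n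 = 0$ for all $i$. The function $g$ is differentiable at every $\bm{x}$ whose nodes are pairwise distinct, and $\nabla g$ is its gradient with respect to $\bm{x}$. *)

theory Defs
  imports "HOL-Analysis.Analysis"
begin

text \<open>
  A configuration of nodes in \<open>\<real>\<^sup>d\<close>, indexed by \<open>'n\<close>, is a vector \<open>x :: real ^ 'd ^ 'n\<close> whose
  component \<open>x $ i\<close> is the position of node \<open>i\<close>. The inner product of this type is the sum of
  the inner products of the blocks, so it is the Euclidean space of stacked vectors
  of dimension \<open>n * d\<close>, and gradients with respect to it are those of the stacked vector.
\<close>

definition sigmoid :: "real \<Rightarrow> real \<Rightarrow> real" where
  "sigmoid w y = 1 / (1 + exp (- w * y))"

definition weighted_adjacency ::
    "real \<Rightarrow> real \<Rightarrow> real ^ 'd ^ 'n \<Rightarrow> real ^ 'n ^ 'n" where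
  "weighted_adjacency w \<epsilon> x =
     (\<chi> i j. if i = j then 0 else sigmoid w (\<epsilon> - norm (x $ i - x $ j)))"

definition weighted_degree ::
    "real \<Rightarrow> real \<Rightarrow> real ^ 'd ^ 'n \<Rightarrow> real ^ 'n ^ 'n" where
  "weighted_degree w \<epsilon> x =
     (\<chi> i j. if i = j then (\<Sum>k\<in>UNIV. weighted_adjacency w \<epsilon> x $ i $ k) else 0)"

definition weighted_laplacian ::
    "real \<Rightarrow> real \<Rightarrow> real ^ 'd ^ 'n \<Rightarrow> real ^ 'n ^ 'n" where
  "weighted_laplacian w \<epsilon> x = weighted_degree w \<epsilon> x - weighted_adjacency w \<epsilon> x"

definition ones :: "real ^ 'n" where
  "ones = (\<chi> i. 1)"

definition orthonormal_columns :: "real ^ 'm ^ 'n \<Rightarrow> bool" where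
  "orthonormal_columns P \<longleftrightarrow>
     (\<forall>k l. column k P \<bullet> column l P = (if k = l then 1 else 0))"

definition connectivity_constraint ::
    "real \<Rightarrow> real \<Rightarrow> real \<Rightarrow> real ^ 'm ^ 'n \<Rightarrow> real ^ 'd ^ 'n \<Rightarrow> real" where
  "connectivity_constraint w \<epsilon> \<tau> P x =
     \<tau> - det (transpose P ** weighted_laplacian w \<epsilon> x ** P)"

end

theory Submission
  imports Defs
begin

text \<open>
  The gradient is tested against the direction \<open>x\<close> itself: dilating the configuration strictly
  decreases every weight. The matrix \<open>M = P\<^sup>T L P\<close> is a nonnegative combination
  of rank-one squares \<open>v v\<^sup>T\<close>, one per pair of nodes, and the derivative of \<open>det\<close> at \<open>M\<close> is
  nonnegative on each of them. By Euler's identity its value at \<open>M\<close> is a positive multiple of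
  \<open>det M = \<tau> > 0\<close>, so it is positive on at least one of the squares. Hence
  \<open>det M\<close> has negative derivative in the direction \<open>x\<close>.
\<close>

section \<open>Rank-one squares\<close>

definition outer_square :: "real ^ 'm \<Rightarrow> real ^ 'm ^ 'm" where
  "outer_square v = (\<chi> i j. v $ i * v $ j)"

lemma outer_square_zero [simp]: "outer_square 0 = 0"
  by (simp add: outer_square_def vec_eq_iff)

lemma inner_outer_square: "x \<bullet> (outer_square v *v x) = (v \<bullet> x)\<^sup>2"
  by (simp add: outer_square_def inner_vec_def matrix_vector_mult_def power2_eq_square
      sum_product sum_distrib_left algebra_simps)

lemma outer_square_congruence:
  "Q ** outer_square v ** transpose Q = outer_square (Q *v v)"
  by (simp add: outer_square_def vec_eq_iff matrix_matrix_mult_def matrix_vector_mult_def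
      transpose_def sum_product sum_distrib_left sum_distrib_right algebra_simps)

section \<open>Determinants: positivity, rank-one updates and derivatives\<close>

lemma det_differentiable: "det differentiable (at (A :: real ^ 'm ^ 'm))"
proof -
  have entry: "((\<lambda>A :: real ^ 'm ^ 'm. A $ i $ j) has_derivative (\<lambda>h. h $ i $ j)) (at A)" for i j
    by (intro bounded_linear_imp_has_derivative
        bounded_linear_compose [OF bounded_linear_vec_nth bounded_linear_vec_nth])
  have "\<exists>D. (det has_derivative D) (at A)"
    unfolding det_def [abs_def]
    by (rule exI, rule has_derivative_sum, rule has_derivative_mult_right,
        rule has_derivative_prod, rule entry)
  then show ?thesis
    by (simp add: differentiable_def)
qed

lemma continuous_on_det_real: "continuous_on S (det :: real ^ 'm ^ 'm \<Rightarrow> real)"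
  by (intro differentiable_imp_continuous_on)
    (simp add: differentiable_on_def det_differentiable differentiable_at_withinI)

text \<open>\<open>A\<close> may be nonsymmetric, so the argument uses a path instead of
  eigenvalues. On the segment from \<open>A\<close> to the identity every matrix other than
  \<open>A\<close> is positive definite, hence invertible, so the determinant cannot pass from a
  negative value to 1.\<close>

lemma det_nonneg_psd:
  fixes A :: "real ^ 'm ^ 'm"
  assumes psd: "\<And>x. 0 \<le> x \<bullet> (A *v x)"
  shows "0 \<le> det A"
proof (rule ccontr)
  assume "\<not> 0 \<le> det A"
  let ?B = "\<lambda>t::real. (1 - t) *\<^sub>R A + t *\<^sub>R mat 1"
  have "continuous_on {0..1} (\<lambda>t. det (?B t))"
    by (intro continuous_on_compose2 [OF continuous_on_det_real [of UNIV]] continuous_intros) auto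
  moreover have "det (?B 0) \<le> 0" "0 \<le> det (?B 1)"
    using \<open>\<not> 0 \<le> det A\<close> by auto
  ultimately obtain t where t: "0 \<le> t" "t \<le> 1" "det (?B t) = 0"
    using IVT' [of "\<lambda>t. det (?B t)" 0 0 1] by auto
  have "t \<noteq> 0"
    using t(3) \<open>\<not> 0 \<le> det A\<close> by auto
  have "x = 0" if "?B t *v x = 0" for x
  proof -
    have "0 = x \<bullet> (?B t *v x)"
      using that by simp
    also have "\<dots> = (1 - t) * (x \<bullet> (A *v x)) + t * (x \<bullet> x)"
      by (simp add: matrix_vector_mult_add_rdistrib scaleR_matrix_vector_assoc [symmetric]
          inner_add_right)
    finally have "t * (x \<bullet> x) \<le> 0"
      using psd [of x] t mult_nonneg_nonneg [of "1 - t" "x \<bullet> (A *v x)"] by linarith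
    then show ?thesis
      using t(1) \<open>t \<noteq> 0\<close> inner_gt_zero_iff [of x] by (fastforce simp: mult_le_0_iff)
  qed
  then have "invertible (?B t)"
    using invertible_left_inverse matrix_left_invertible_ker by blast
  then show False
    using t(3) by (simp add: invertible_det_nz)
qed

lemma matrix_add_rdistrib: "(A + B) ** C = A ** C + B ** C"
  by (simp add: matrix_matrix_mult_def vec_eq_iff sum.distrib distrib_right)

lemma matrix_vector_mult_sum_rdistrib: "sum f S *v x = (\<Sum>i\<in>S. f i *v x)"
  by (induction S rule: infinite_finite_induct) (simp_all add: matrix_vector_mult_add_rdistrib)

text \<open>An orthogonal change of basis turns \<open>v\<close> into a multiple of an axis vector.
  The perturbation then affects a single row, and the determinant is linear in each row.\<close>

lemma det_rank_one_affine:
  fixes A :: "real ^ 'm ^ 'm"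
  obtains c where "\<And>s. det (A + s *\<^sub>R outer_square v) = det A + s * c"
proof -
  obtain k :: 'm where True by simp
  have "norm v = norm (norm v *\<^sub>R (axis k 1 :: real ^ 'm))"
    by simp
  then obtain f :: "real ^ 'm \<Rightarrow> real ^ 'm" where f: "orthogonal_transformation f" "f v = norm v *\<^sub>R axis k 1"
    using orthogonal_transformation_exists by blast
  define Q where "Q = matrix f"
  have Q: "orthogonal_matrix Q" and Qv: "Q *v v = norm v *\<^sub>R axis k 1"
    using f orthogonal_transformation_matrix unfolding Q_def
    by (auto simp: orthogonal_transformation_def linear_linear matrix_works)
  have det_Q: "det (Q ** X ** transpose Q) = det X" for X
    using det_orthogonal_matrix [OF Q] by (auto simp: det_mul det_transpose)
  let ?B = "Q ** A ** transpose Q"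
  \<comment> \<open>The determinant here is the \<open>(k, k)\<close> cofactor of \<open>?B\<close>.
    The factor \<open>(norm v)\<^sup>2\<close> is the only nonzero entry of the square of
    \<open>Q *v v\<close>, when there is one.\<close>
  let ?c = "(norm v)\<^sup>2 * det (\<chi> i. if i = k then axis k 1 else ?B $ i)"
  have "det (A + s *\<^sub>R outer_square v) = det A + s * ?c" for s
  proof -
    have "det (A + s *\<^sub>R outer_square v) =
        det (Q ** (A + s *\<^sub>R outer_square v) ** transpose Q)"
      by (simp add: det_Q)
    also have "Q ** (A + s *\<^sub>R outer_square v) ** transpose Q =
        ?B + s *\<^sub>R (Q ** outer_square v ** transpose Q)"
      by (simp add: matrix_add_ldistrib matrix_add_rdistrib matrix_scalar_ac
          scalar_matrix_assoc)
    also have "\<dots> = (\<chi> i. if i = k then ?B $ i + (s * (norm v)\<^sup>2) *s axis k 1 else ?B $ i)"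
      unfolding outer_square_congruence Qv
      by (auto simp: outer_square_def vec_eq_iff axis_def power2_eq_square)
    also have "det \<dots> = det (\<chi> i. if i = k then ?B $ i else ?B $ i) + s * ?c"
      by (subst det_row_add, subst det_row_mul) (simp add: mult.assoc)
    also have "det (\<chi> i. if i = k then ?B $ i else ?B $ i) = det A"
      by (simp add: det_Q)
    finally show ?thesis .
  qed
  then show thesis ..
qed

text \<open>
  The determinant is affine along the ray \<open>A + s v v\<^sup>T\<close> and nonnegative for \<open>s \<ge> 0\<close>, so its
  slope there is nonnegative.
\<close>

lemma det_derivative_outer_square_nonneg:
  fixes A :: "real ^ 'm ^ 'm"
  assumes psd: "\<And>x. 0 \<le> x \<bullet> (A *v x)" and D: "(det has_derivative D) (at A)"
  shows "0 \<le> D (outer_square v)"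
proof -
  obtain c where c: "\<And>s. det (A + s *\<^sub>R outer_square v) = det A + s * c"
    using det_rank_one_affine [of A v] by blast
  have "((\<lambda>s. det (A + s *\<^sub>R outer_square v)) has_derivative
      (\<lambda>h. D (h *\<^sub>R outer_square v))) (at 0)"
    by (rule has_derivative_compose [where g = det]) (auto intro!: derivative_eq_intros D)
  moreover have "((\<lambda>s. det A + s * c) has_derivative (\<lambda>h. h * c)) (at 0)"
    by (auto intro!: derivative_eq_intros)
  ultimately have "(\<lambda>h. D (h *\<^sub>R outer_square v)) = (\<lambda>h. h * c)"
    unfolding c by (rule has_derivative_unique)
  from fun_cong [OF this, of 1] have D_eq: "D (outer_square v) = c"
    by simp
  have nonneg: "0 \<le> det A + s * c" if "0 \<le> s" for s
    unfolding c [symmetric]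
    by (rule det_nonneg_psd)
      (use that psd in \<open>simp add: matrix_vector_mult_add_rdistrib
          scaleR_matrix_vector_assoc [symmetric] inner_add_right inner_outer_square\<close>)
  have "0 \<le> c"
  proof (rule ccontr)
    assume "\<not> 0 \<le> c"
    moreover have "0 \<le> det A"
      using nonneg [of 0] by simp
    ultimately show False
      \<comment> \<open>With a negative slope, the affine function takes the value -1 at this
        parameter.\<close>
      using nonneg [of "(det A + 1) / - c"] by (auto simp: field_simps)
  qed
  then show ?thesis
    by (simp add: D_eq)
qed

text \<open>Euler's identity: the determinant is homogeneous of degree \<open>CARD('m)\<close>, and
  \<open>s \<mapsto> det (s *\<^sub>R A)\<close> is differentiated at 1 in two ways.\<close>

lemma det_derivative_self:
  fixes A :: "real ^ 'm ^ 'm"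
  assumes D: "(det has_derivative D) (at A)"
  shows "D A = real CARD('m) * det A"
proof -
  have hom: "det (s *\<^sub>R A) = s ^ CARD('m) * det A" for s
    using det_rows_mul [of "\<lambda>_. s" "\<lambda>i. A $ i"]
    by (simp add: scaleR_vec_def scalar_mult_eq_scaleR)
  have "((\<lambda>s. det (s *\<^sub>R A)) has_derivative (\<lambda>h. D (h *\<^sub>R A))) (at 1)"
    by (rule has_derivative_compose [where g = det]) (auto intro!: derivative_eq_intros D)
  moreover have "((\<lambda>s. s ^ CARD('m) * det A) has_derivative
      (\<lambda>h. h * (real CARD('m) * det A))) (at 1)"
    by (auto intro!: derivative_eq_intros)
  ultimately have "(\<lambda>h. D (h *\<^sub>R A)) = (\<lambda>h. h * (real CARD('m) * det A))"
    unfolding hom by (rule has_derivative_unique)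
  from fun_cong [OF this, of 1] show ?thesis
    by simp
qed

section \<open>The Laplacian as a sum over edges\<close>

text \<open>The quadratic form of a Laplacian sums weighted squared differences over edges.
  Congruence by \<open>P\<close> turns the difference of two axis vectors into the difference of two
  rows of \<open>P\<close>; the factor 1/2 is there because the sum runs over ordered pairs.\<close>

lemma laplacian_congruence:
  fixes P :: "real ^ 'm ^ 'n" and x :: "real ^ 'd ^ 'n"
  shows "transpose P ** weighted_laplacian w \<epsilon> x ** P =
    (\<Sum>(i, j)\<in>UNIV. (weighted_adjacency w \<epsilon> x $ i $ j / 2) *\<^sub>R outer_square (P $ i - P $ j))"
proof -
  let ?a = "\<lambda>i j. weighted_adjacency w \<epsilon> x $ i $ j"
  have sym: "?a i j = ?a j i" for i j
    by (simp add: weighted_adjacency_def norm_minus_commute)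
  have "(transpose P ** weighted_laplacian w \<epsilon> x ** P) $ k $ l =
      (\<Sum>i\<in>UNIV. \<Sum>j\<in>UNIV. ?a i j / 2 * ((P $ i - P $ j) $ k * (P $ i - P $ j) $ l))" for k l
  proof -
    have L: "weighted_laplacian w \<epsilon> x $ i $ j = (if i = j then \<Sum>r\<in>UNIV. ?a i r else 0) - ?a i j" for i j
      by (simp add: weighted_laplacian_def weighted_degree_def)
    have swap: "(\<Sum>i\<in>UNIV. \<Sum>j\<in>UNIV. ?a i j * (P $ j $ k * P $ j $ l)) =
        (\<Sum>i\<in>UNIV. \<Sum>j\<in>UNIV. ?a i j * (P $ i $ k * P $ i $ l))"
      by (subst sum.swap) (simp add: sym)
    have swap': "(\<Sum>i\<in>UNIV. \<Sum>j\<in>UNIV. ?a i j * (P $ j $ k * P $ i $ l)) =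
        (\<Sum>i\<in>UNIV. \<Sum>j\<in>UNIV. ?a i j * (P $ i $ k * P $ j $ l))"
      by (subst sum.swap) (simp add: sym)
    have "(transpose P ** weighted_laplacian w \<epsilon> x ** P) $ k $ l =
        (\<Sum>j\<in>UNIV. \<Sum>i\<in>UNIV. P $ i $ k * weighted_laplacian w \<epsilon> x $ i $ j * P $ j $ l)"
      by (simp add: matrix_matrix_mult_def transpose_def sum_distrib_right)
    also have "\<dots> = (\<Sum>i\<in>UNIV. \<Sum>j\<in>UNIV. P $ i $ k * weighted_laplacian w \<epsilon> x $ i $ j * P $ j $ l)"
      by (rule sum.swap)
    also have "\<dots> = (\<Sum>i\<in>UNIV. \<Sum>j\<in>UNIV.
        (if i = j then (\<Sum>r\<in>UNIV. ?a i r) * (P $ i $ k * P $ j $ l) else 0)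
        - ?a i j * (P $ i $ k * P $ j $ l))"
      by (intro sum.cong refl) (simp add: L algebra_simps)
    also have "\<dots> = (\<Sum>i\<in>UNIV. \<Sum>j\<in>UNIV. ?a i j * (P $ i $ k * P $ i $ l))
        - (\<Sum>i\<in>UNIV. \<Sum>j\<in>UNIV. ?a i j * (P $ i $ k * P $ j $ l))"
      by (simp add: sum_subtractf sum_distrib_right)
    \<comment> \<open>Each sum is averaged with its copy under exchange of \<open>i\<close> and
      \<open>j\<close>; the four resulting terms are those of the expanded product of
      differences.\<close>
    also have "\<dots> = ((\<Sum>i\<in>UNIV. \<Sum>j\<in>UNIV. ?a i j * (P $ i $ k * P $ i $ l))
        + (\<Sum>i\<in>UNIV. \<Sum>j\<in>UNIV. ?a i j * (P $ j $ k * P $ j $ l))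
        - (\<Sum>i\<in>UNIV. \<Sum>j\<in>UNIV. ?a i j * (P $ i $ k * P $ j $ l))
        - (\<Sum>i\<in>UNIV. \<Sum>j\<in>UNIV. ?a i j * (P $ j $ k * P $ i $ l))) / 2"
      by (simp add: swap swap')
    also have "\<dots> = (\<Sum>i\<in>UNIV. \<Sum>j\<in>UNIV. ?a i j / 2 * ((P $ i - P $ j) $ k * (P $ i - P $ j) $ l))"
      unfolding sum.distrib [symmetric] sum_subtractf [symmetric] sum_divide_distrib
      by (intro sum.cong refl) (simp add: field_simps)
    finally show ?thesis .
  qed
  then show ?thesis
    by (simp add: vec_eq_iff outer_square_def sum.cartesian_product case_prod_unfold
        flip: UNIV_Times_UNIV)
qed

section \<open>Weights and their derivatives\<close>

lemma sigmoid_pos: "0 < sigmoid w y"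
  by (simp add: sigmoid_def add_pos_pos)

lemma sigmoid_has_positive_derivative:
  assumes "0 < w"
  obtains s where "0 < s" "(sigmoid w has_real_derivative s) (at y)"
proof
  have "1 + exp (- w * y) \<noteq> 0"
    using exp_gt_zero [of "- w * y"] by linarith
  then show "(sigmoid w has_real_derivative
      w * exp (- w * y) / (1 + exp (- w * y))\<^sup>2) (at y)"
    unfolding sigmoid_def [abs_def]
    by (auto intro!: derivative_eq_intros simp: power2_eq_square)
  show "0 < w * exp (- w * y) / (1 + exp (- w * y))\<^sup>2"
    using assms by (simp add: add_pos_pos zero_less_divide_iff less_imp_neq [symmetric])
qed

text \<open>Distinct positions keep the norm away from its singularity at 0. In the direction
  \<open>x\<close> the distance grows at a rate equal to itself, which is positive, while the
  sigmoid of \<open>\<epsilon>\<close> minus the distance decreases.\<close>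

lemma weighted_adjacency_has_derivative:
  fixes x :: "real ^ 'd ^ 'n"
  assumes "0 < w" "i \<noteq> j" "x $ i \<noteq> x $ j"
  obtains D where "((\<lambda>x. weighted_adjacency w \<epsilon> x $ i $ j) has_derivative D) (at x)" "D x < 0"
proof -
  let ?z = "x $ i - x $ j"
  obtain s where s: "0 < s" "(sigmoid w has_real_derivative s) (at (\<epsilon> - norm ?z))"
    using sigmoid_has_positive_derivative \<open>0 < w\<close> .
  have "((\<lambda>x. x $ i - x $ j) has_derivative (\<lambda>h. h $ i - h $ j)) (at x)"
    by (intro bounded_linear_imp_has_derivative bounded_linear_sub bounded_linear_vec_nth)
  then have "((\<lambda>x. norm (x $ i - x $ j)) has_derivative (\<lambda>h. (h $ i - h $ j) \<bullet> sgn ?z)) (at x)"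
    by (rule has_derivative_compose) (use assms(3) in \<open>simp add: has_derivative_norm\<close>)
  then have "((\<lambda>x. \<epsilon> - norm (x $ i - x $ j)) has_derivative
      (\<lambda>h. - ((h $ i - h $ j) \<bullet> sgn ?z))) (at x)"
    by (auto intro!: derivative_eq_intros)
  then have "((\<lambda>x. sigmoid w (\<epsilon> - norm (x $ i - x $ j))) has_derivative
      (\<lambda>h. s * - ((h $ i - h $ j) \<bullet> sgn ?z))) (at x)"
    by (rule has_derivative_compose [where g = "sigmoid w"])
      (rule s(2) [unfolded has_field_derivative_def])
  then have "((\<lambda>x. weighted_adjacency w \<epsilon> x $ i $ j) has_derivative
      (\<lambda>h. s * - ((h $ i - h $ j) \<bullet> sgn ?z))) (at x)"
    using \<open>i \<noteq> j\<close> by (simp add: weighted_adjacency_def)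
  moreover have "s * - (?z \<bullet> sgn ?z) < 0"
    using s(1) assms(3)
    by (simp add: sgn_div_norm zero_less_mult_iff)
  ultimately show thesis ..
qed

theorem theoremV1:
  fixes w \<epsilon> \<tau> :: real
    and P :: "real ^ 'm ^ 'n"
    and x :: "real ^ 'd ^ 'n"
  assumes "CARD('n) \<ge> 2" and "CARD('m) = CARD('n) - 1"
    and "w > 0" and "\<epsilon> > 0" and "\<tau> > 0"
    and "orthonormal_columns P"
    and "\<And>k. column k P \<bullet> ones = 0"
    and "\<And>i j. i \<noteq> j \<Longrightarrow> x $ i \<noteq> x $ j"
    and "connectivity_constraint w \<epsilon> \<tau> P x = 0"
  shows "\<exists>D. GDERIV (connectivity_constraint w \<epsilon> \<tau> P) x :> D \<and> D \<noteq> 0"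
proof -
  define a where "a = (\<lambda>(i, j) x :: real ^ 'd ^ 'n. weighted_adjacency w \<epsilon> x $ i $ j / 2)"
  define v where "v = (\<lambda>(i, j). P $ i - P $ j)"
  define M where "M = (\<lambda>x. \<Sum>e\<in>UNIV. a e x *\<^sub>R outer_square (v e))"
  have g_eq: "connectivity_constraint w \<epsilon> \<tau> P = (\<lambda>x. \<tau> - det (M x))"
    by (simp add: fun_eq_iff connectivity_constraint_def laplacian_congruence M_def a_def v_def
        case_prod_unfold)
  have a_nonneg: "0 \<le> a e x" for e
    by (auto simp: a_def weighted_adjacency_def less_imp_le [OF sigmoid_pos] split: prod.split)
  \<comment> \<open>Diagonal weights are constantly 0; for all other pairs only the sign of the
    derivative along \<open>x\<close> is kept.\<close>
  have "\<exists>D. (a e has_derivative D) (at x) \<and> (if fst e = snd e then D x = 0 else D x < 0)" for e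
  proof (cases e)
    case (Pair i j)
    show ?thesis
    proof (cases "i = j")
      case True
      then show ?thesis
        by (intro exI [of _ "\<lambda>_. 0"]) (simp add: a_def Pair weighted_adjacency_def)
    next
      case False
      then obtain D where
        "((\<lambda>x. weighted_adjacency w \<epsilon> x $ i $ j) has_derivative D) (at x)" "D x < 0"
        using weighted_adjacency_has_derivative assms(3,8) by metis
      then show ?thesis
        using False
        by (intro exI [of _ "\<lambda>h. D h / 2"]) (auto simp: a_def Pair intro!: derivative_eq_intros)
    qed
  qed
  then obtain a' where a': "\<And>e. (a e has_derivative a' e) (at x)"
    and a'_sign: "\<And>e. if fst e = snd e then a' e x = 0 else a' e x < 0"
    by metis
  obtain D where D: "(det has_derivative D) (at (M x))"
    using det_differentiable unfolding differentiable_def by blast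
  interpret D: bounded_linear D
    using D by (rule has_derivative_bounded_linear)
  have psd: "0 \<le> y \<bullet> (M x *v y)" for y
  proof -
    have "y \<bullet> (M x *v y) = (\<Sum>e\<in>UNIV. a e x * (v e \<bullet> y)\<^sup>2)"
      by (simp add: M_def matrix_vector_mult_sum_rdistrib inner_sum_right
          scaleR_matrix_vector_assoc [symmetric] inner_outer_square)
    then show ?thesis
      by (simp add: a_nonneg sum_nonneg)
  qed
  \<comment> \<open>\<open>d e\<close> is the rate at which the determinant responds to the weight
    \<open>a e\<close> at the configuration \<open>x\<close>.\<close>
  define d where "d = (\<lambda>e. D (outer_square (v e)))"
  have d_nonneg: "0 \<le> d e" for e
    unfolding d_def using psd D by (rule det_derivative_outer_square_nonneg)
  \<comment> \<open>Euler's identity enters here, and \<open>g = 0\<close> fixes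
    \<open>det (M x)\<close> at \<open>\<tau>\<close>. Positivity of the sum yields a pair
    \<open>e\<close> to which the determinant really responds.\<close>
  have "(\<Sum>e\<in>UNIV. a e x * d e) = D (M x)"
    by (simp add: M_def d_def D.sum D.scaleR)
  also have "\<dots> = real CARD('m) * \<tau>"
    using assms(9) det_derivative_self [OF D] by (simp add: g_eq)
  also have "\<dots> > 0"
    using \<open>\<tau> > 0\<close> by simp
  finally have "(\<Sum>e\<in>UNIV. a e x * d e) \<noteq> 0"
    by simp
  then obtain e where "a e x * d e \<noteq> 0"
    by (rule sum.not_neutral_contains_not_neutral)
  then have e: "d e \<noteq> 0"
    by simp
  \<comment> \<open>On a diagonal pair \<open>v e\<close> is 0, which would force
    \<open>d e = 0\<close>. So the weight of this pair strictly decreases along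
    \<open>x\<close>.\<close>
  then have "fst e \<noteq> snd e"
    by (auto simp: d_def v_def case_prod_unfold D.zero)
  have M': "(M has_derivative (\<lambda>h. \<Sum>e\<in>UNIV. a' e h *\<^sub>R outer_square (v e))) (at x)"
    unfolding M_def by (intro has_derivative_sum has_derivative_scaleR_left a')
  define g' where "g' = (\<lambda>h. - D (\<Sum>e\<in>UNIV. a' e h *\<^sub>R outer_square (v e)))"
  have g': "(connectivity_constraint w \<epsilon> \<tau> P has_derivative g') (at x)"
    unfolding g_eq g'_def
    using has_derivative_diff [OF has_derivative_const has_derivative_compose [OF M' D]] by simp
  \<comment> \<open>By the chain rule the left side is the derivative of \<open>det (M x)\<close>
    along \<open>x\<close>, that is, \<open>- g' x\<close>. No term is positive, and the pair
    \<open>e\<close> found above contributes a negative one.\<close>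
  have "(\<Sum>e\<in>UNIV. a' e x * d e) < (\<Sum>e\<in>(UNIV :: ('n \<times> 'n) set). 0)"
  proof (rule sum_strict_mono_ex1)
    show "\<forall>e\<in>UNIV. a' e x * d e \<le> 0"
      using a'_sign d_nonneg by (metis less_imp_le mult_nonpos_nonneg order_refl)
    have "a' e x * d e < 0"
      using a'_sign [of e] \<open>fst e \<noteq> snd e\<close> e d_nonneg [of e] by (simp add: mult_neg_pos)
    then show "\<exists>e\<in>UNIV. a' e x * d e < 0"
      by blast
  qed simp
  then have "g' x \<noteq> 0"
    by (simp add: g'_def d_def D.sum D.scaleR)
  interpret g': bounded_linear g'
    using g' by (rule has_derivative_bounded_linear)
  \<comment> \<open>The gradient is the vector representing the functional \<open>g'\<close> through
    the inner product, which is the adjoint of \<open>g'\<close> at 1.\<close>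
  let ?G = "adjoint g' 1"
  have "g' h = h \<bullet> ?G" for h
    using adjoint_works [OF g'.linear_axioms, of h 1] by simp
  then have "GDERIV (connectivity_constraint w \<epsilon> \<tau> P) x :> ?G" "?G \<noteq> 0"
    using g' \<open>g' x \<noteq> 0\<close> unfolding gderiv_def by (metis ext, metis inner_zero_right)
  then show ?thesis
    by blast
qed

end
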